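(* Let $\mathbf{M}=\langle M,\oplus,{}',0\rangle$ be an MV-algebra. Define, for $x,y\in M$, $x+y=(x'\oplus y)'\oplus y$, $x\cdot y=(x'\oplus y')'$, $\alpha(x)=x'$, and $1=0'$. Then the structure $\mathbf{R}(\mathbf{M})=\langle M,+,\cdot,\alpha,0,1\rangle$ is a Łukasiewicz semiring.
   Context: An MV-algebra is an algebra $\langle M,\oplus,{}',0\rangle$ of type $\langle 2,1,0\rangle$ such that $\langle M,\oplus,0\rangle$ is a commutative monoid, $x''=x$, $x\oplus 0'=0'$, and $(x'\oplus y)'\oplus y=(y'\oplus x)'\oplus x$. A semiring is an algebra $\langle R,+,\cdot,0,1\rangle$ such that $\langle R,+,0\rangle$ is a commutative monoid, $\langle R,\cdot,1\rangle$ is a monoid, both distributive laws $(x+y)\cdot z=(x\cdot z)+(y\cdot z)$ and $x\cdot(y+z)=(x\cdot y)+(x\cdot z)$ hold, and $x\cdot 0=0\cdot x=0$. If $x+x=x$ holds (idempotency), then $x\le y$ iff $x+y=y$ defines a partial order. A Łukasiewicz semiring is an idempotent semiring together with a map $\alpha:R\to R$ such that $\alpha(\alpha(x))=x$; $x\le y$ implies $\alpha(y)\le\alpha(x)$; and $\alpha(x\cdot\alpha(y))\cdot\alpha(y)=\alpha(y\cdot\alpha(x))\cdot\alpha(x)$ for all $x,y$. *)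

theory Defs
  imports "HOL-Algebra.Ring"
begin

record 'a mv_structure = "'a partial_object" +
  mv_plus :: "['a, 'a] \<Rightarrow> 'a"  (infixl "\<boxplus>\<index>" 65)
  mv_neg :: "'a \<Rightarrow> 'a"  ("\<sim>\<index> _" [81] 80)
  mv_zero :: 'a  ("\<zero>\<^sub>m\<index>")

locale mv_algebra =
  fixes M :: "('a, 'm) mv_structure_scheme" (structure)
  assumes comm_monoid_mv_plus:
      "comm_monoid \<lparr>carrier = carrier M, monoid.mult = mv_plus M, one = mv_zero M\<rparr>"
    and neg_closed: "x \<in> carrier M \<Longrightarrow> \<sim> x \<in> carrier M"
    and neg_neg: "x \<in> carrier M \<Longrightarrow> \<sim> (\<sim> x) = x"
    and plus_neg_zero: "x \<in> carrier M \<Longrightarrow> x \<boxplus> \<sim> \<zero>\<^sub>m = \<sim> \<zero>\<^sub>m"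
    and lukasiewicz_axiom:
      "\<lbrakk>x \<in> carrier M; y \<in> carrier M\<rbrakk>
        \<Longrightarrow> \<sim> (\<sim> x \<boxplus> y) \<boxplus> y = \<sim> (\<sim> y \<boxplus> x) \<boxplus> x"

text \<open>The library locale \<open>semiring\<close> has exactly the required axioms: multiplication need
  not be commutative, and zero and one may coincide.\<close>

locale idempotent_semiring = semiring +
  assumes add_idem: "x \<in> carrier R \<Longrightarrow> x \<oplus> x = x"

definition semiring_le :: "('a, 'm) ring_scheme \<Rightarrow> 'a \<Rightarrow> 'a \<Rightarrow> bool"  (infix "\<sqsubseteq>\<^sub>+\<index>" 50)
  where "x \<sqsubseteq>\<^sub>+\<^bsub>R\<^esub> y \<longleftrightarrow> x \<oplus>\<^bsub>R\<^esub> y = y"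

record 'a luk_structure = "'a ring" +
  luk_alpha :: "'a \<Rightarrow> 'a"  ("\<alpha>\<index>")

locale lukasiewicz_semiring = idempotent_semiring R
  for R :: "('a, 'm) luk_structure_scheme" (structure) +
  assumes alpha_closed: "x \<in> carrier R \<Longrightarrow> \<alpha> x \<in> carrier R"
    and alpha_alpha: "x \<in> carrier R \<Longrightarrow> \<alpha> (\<alpha> x) = x"
    and alpha_antimono:
      "\<lbrakk>x \<in> carrier R; y \<in> carrier R; x \<sqsubseteq>\<^sub>+ y\<rbrakk> \<Longrightarrow> \<alpha> y \<sqsubseteq>\<^sub>+ \<alpha> x"
    and alpha_mult:
      "\<lbrakk>x \<in> carrier R; y \<in> carrier R\<rbrakk>
        \<Longrightarrow> \<alpha> (x \<otimes> \<alpha> y) \<otimes> \<alpha> y = \<alpha> (y \<otimes> \<alpha> x) \<otimes> \<alpha> x"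

definition luk_semiring_of :: "('a, 'm) mv_structure_scheme \<Rightarrow> 'a luk_structure"
  where "luk_semiring_of M =
    \<lparr>carrier = carrier M,
     monoid.mult = (\<lambda>x y. \<sim>\<^bsub>M\<^esub> (\<sim>\<^bsub>M\<^esub> x \<boxplus>\<^bsub>M\<^esub> \<sim>\<^bsub>M\<^esub> y)),
     one = \<sim>\<^bsub>M\<^esub> \<zero>\<^sub>m\<^bsub>M\<^esub>,
     ring.zero = \<zero>\<^sub>m\<^bsub>M\<^esub>,
     add = (\<lambda>x y. \<sim>\<^bsub>M\<^esub> (\<sim>\<^bsub>M\<^esub> x \<boxplus>\<^bsub>M\<^esub> y) \<boxplus>\<^bsub>M\<^esub> y),
     luk_alpha = (\<lambda>x. \<sim>\<^bsub>M\<^esub> x)\<rparr>"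

end

theory Submission
  imports Defs
begin

text \<open>An MV-algebra is ordered by \<open>x \<le> y \<longleftrightarrow> x' \<oplus> y = 1\<close>. For this order the semiring sum is
  the binary supremum, and the product is residuated: \<open>x \<cdot> y \<le> z \<longleftrightarrow> x \<le> y' \<oplus> z\<close>. Hence the
  product preserves suprema, which is distributivity; the remaining axioms are immediate.\<close>

context mv_algebra
begin

definition mv_le :: "'a \<Rightarrow> 'a \<Rightarrow> bool"
  where "mv_le x y \<longleftrightarrow> \<sim> x \<boxplus> y = \<sim> \<zero>\<^sub>m"

definition mv_join :: "'a \<Rightarrow> 'a \<Rightarrow> 'a"
  where "mv_join x y = \<sim> (\<sim> x \<boxplus> y) \<boxplus> y"

definition mv_mult :: "'a \<Rightarrow> 'a \<Rightarrow> 'a"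
  where "mv_mult x y = \<sim> (\<sim> x \<boxplus> \<sim> y)"

text \<open>The monoid axiom speaks about an auxiliary record; its consequences are restated here
  for the operations of \<open>M\<close> itself.\<close>

lemma plus_closed [simp]: "x \<in> carrier M \<Longrightarrow> y \<in> carrier M \<Longrightarrow> x \<boxplus> y \<in> carrier M"
  and zero_closed [simp]: "\<zero>\<^sub>m \<in> carrier M"
  and plus_assoc:
    "x \<in> carrier M \<Longrightarrow> y \<in> carrier M \<Longrightarrow> z \<in> carrier M \<Longrightarrow> x \<boxplus> y \<boxplus> z = x \<boxplus> (y \<boxplus> z)"
  and plus_commute: "x \<in> carrier M \<Longrightarrow> y \<in> carrier M \<Longrightarrow> x \<boxplus> y = y \<boxplus> x"
  and zero_plus [simp]: "x \<in> carrier M \<Longrightarrow> \<zero>\<^sub>m \<boxplus> x = x"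
  and plus_zero [simp]: "x \<in> carrier M \<Longrightarrow> x \<boxplus> \<zero>\<^sub>m = x"
proof -
  interpret comm_monoid "\<lparr>carrier = carrier M, monoid.mult = mv_plus M, one = mv_zero M\<rparr>"
    by (rule comm_monoid_mv_plus)
  show "x \<in> carrier M \<Longrightarrow> y \<in> carrier M \<Longrightarrow> x \<boxplus> y \<in> carrier M"
    using m_closed by simp
  show "\<zero>\<^sub>m \<in> carrier M"
    using one_closed by simp
  show "x \<in> carrier M \<Longrightarrow> y \<in> carrier M \<Longrightarrow> z \<in> carrier M \<Longrightarrow> x \<boxplus> y \<boxplus> z = x \<boxplus> (y \<boxplus> z)"
    using m_assoc by simp
  show "x \<in> carrier M \<Longrightarrow> y \<in> carrier M \<Longrightarrow> x \<boxplus> y = y \<boxplus> x"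
    using m_comm by simp
  show "x \<in> carrier M \<Longrightarrow> \<zero>\<^sub>m \<boxplus> x = x"
    using l_one by simp
  show "x \<in> carrier M \<Longrightarrow> x \<boxplus> \<zero>\<^sub>m = x"
    using r_one by simp
qed

lemmas [simp] = neg_closed neg_neg plus_neg_zero

lemma neg_zero_plus [simp]: "x \<in> carrier M \<Longrightarrow> \<sim> \<zero>\<^sub>m \<boxplus> x = \<sim> \<zero>\<^sub>m"
  by (simp add: plus_commute [of "\<sim> \<zero>\<^sub>m"])

lemma join_closed [simp]: "x \<in> carrier M \<Longrightarrow> y \<in> carrier M \<Longrightarrow> mv_join x y \<in> carrier M"
  by (simp add: mv_join_def)

lemma mult_closed [simp]: "x \<in> carrier M \<Longrightarrow> y \<in> carrier M \<Longrightarrow> mv_mult x y \<in> carrier M"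
  by (simp add: mv_mult_def)

lemma join_commute: "x \<in> carrier M \<Longrightarrow> y \<in> carrier M \<Longrightarrow> mv_join x y = mv_join y x"
  unfolding mv_join_def by (rule lukasiewicz_axiom)

lemma mult_commute: "x \<in> carrier M \<Longrightarrow> y \<in> carrier M \<Longrightarrow> mv_mult x y = mv_mult y x"
  by (simp add: mv_mult_def plus_commute)

lemma mult_assoc:
  "x \<in> carrier M \<Longrightarrow> y \<in> carrier M \<Longrightarrow> z \<in> carrier M \<Longrightarrow>
    mv_mult (mv_mult x y) z = mv_mult x (mv_mult y z)"
  by (simp add: mv_mult_def plus_assoc)

text \<open>The Lukasiewicz axiom for \<open>\<sim> \<zero>\<^sub>m\<close> and \<open>x\<close> has
  left side \<open>\<sim> x \<boxplus> x\<close>, while its right side is absorbed by the top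
  element.\<close>

lemma le_refl [simp]: "x \<in> carrier M \<Longrightarrow> mv_le x x"
  using lukasiewicz_axiom [of "\<sim> \<zero>\<^sub>m" x] by (simp add: mv_le_def)

lemma join_absorb: "y \<in> carrier M \<Longrightarrow> mv_le x y \<Longrightarrow> mv_join x y = y"
  by (simp add: mv_le_def mv_join_def)

lemma le_plus:
  assumes "x \<in> carrier M" "z \<in> carrier M"
  shows "mv_le x (z \<boxplus> x)"
proof -
  have "\<sim> x \<boxplus> (z \<boxplus> x) = (\<sim> x \<boxplus> x) \<boxplus> z"
    using assms by (simp add: plus_assoc plus_commute [of z])
  then show ?thesis
    using assms le_refl [of x] by (simp add: mv_le_def)
qed

text \<open>The order is the divisibility order of the additive monoid. In this form, transitivity
  and monotonicity of the sum reduce to associativity.\<close>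

lemma le_iff_ex_plus:
  assumes "x \<in> carrier M" "y \<in> carrier M"
  shows "mv_le x y \<longleftrightarrow> (\<exists>z\<in>carrier M. y = z \<boxplus> x)"
proof
  assume "mv_le x y"
  \<comment> \<open>The witness is the truncated difference
    \<open>\<sim> (\<sim> y \<boxplus> x)\<close>: commuting the join turns
    \<open>y = mv_join x y\<close> into a sum ending in \<open>x\<close>.\<close>
  then have "y = \<sim> (\<sim> y \<boxplus> x) \<boxplus> x"
    using assms join_absorb [of y x] join_commute [of x y] by (simp add: mv_join_def)
  then show "\<exists>z\<in>carrier M. y = z \<boxplus> x"
    using assms by (meson neg_closed plus_closed)
next
  assume "\<exists>z\<in>carrier M. y = z \<boxplus> x"
  then show "mv_le x y"
    using assms le_plus by blast
qed

lemma le_antisym: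
  assumes "x \<in> carrier M" "y \<in> carrier M" "mv_le x y" "mv_le y x"
  shows "x = y"
  using assms join_absorb join_commute by metis

lemma le_trans:
  assumes "x \<in> carrier M" "y \<in> carrier M" "z \<in> carrier M" "mv_le x y" "mv_le y z"
  shows "mv_le x z"
proof -
  obtain u v where "u \<in> carrier M" "v \<in> carrier M" "y = u \<boxplus> x" "z = v \<boxplus> y"
    using assms by (auto simp: le_iff_ex_plus)
  then have "z = (v \<boxplus> u) \<boxplus> x" and "v \<boxplus> u \<in> carrier M"
    using assms by (simp_all add: plus_assoc)
  then show ?thesis
    using assms le_plus by simp
qed

lemma plus_mono:
  assumes "x \<in> carrier M" "y \<in> carrier M" "z \<in> carrier M" "mv_le x y"
  shows "mv_le (x \<boxplus> z) (y \<boxplus> z)"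
proof -
  obtain u where "u \<in> carrier M" "y = u \<boxplus> x"
    using assms by (auto simp: le_iff_ex_plus)
  then have "y \<boxplus> z = u \<boxplus> (x \<boxplus> z)"
    using assms by (simp add: plus_assoc)
  then show ?thesis
    using assms \<open>u \<in> carrier M\<close> le_plus by simp
qed

text \<open>After cancelling double negation, both inequalities are the same equation up to
  commutativity.\<close>

lemma neg_antimono:
  "x \<in> carrier M \<Longrightarrow> y \<in> carrier M \<Longrightarrow> mv_le x y \<Longrightarrow> mv_le (\<sim> y) (\<sim> x)"
  by (simp add: mv_le_def plus_commute)

lemma le_join2: "x \<in> carrier M \<Longrightarrow> y \<in> carrier M \<Longrightarrow> mv_le y (mv_join x y)"
  by (simp add: mv_join_def le_plus)

lemma le_join1: "x \<in> carrier M \<Longrightarrow> y \<in> carrier M \<Longrightarrow> mv_le x (mv_join x y)"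
  using le_join2 join_commute by metis

text \<open>The first argument of a join stands under two negations, so the join is monotone in it.
  Raising \<open>x\<close> to \<open>z\<close> gives \<open>mv_join z y\<close>, which collapses to
  \<open>z\<close> because \<open>y\<close> lies below \<open>z\<close>.\<close>

lemma join_least:
  assumes "x \<in> carrier M" "y \<in> carrier M" "z \<in> carrier M" "mv_le x z" "mv_le y z"
  shows "mv_le (mv_join x y) z"
proof -
  have "mv_le (mv_join x y) (mv_join z y)"
    unfolding mv_join_def using assms by (intro plus_mono neg_antimono) simp_all
  moreover have "mv_join z y = z"
    using assms join_absorb join_commute by metis
  ultimately show ?thesis by simp
qed

lemma join_le_iff:
  assumes "x \<in> carrier M" "y \<in> carrier M" "z \<in> carrier M"
  shows "mv_le (mv_join x y) z \<longleftrightarrow> mv_le x z \<and> mv_le y z"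
  using assms join_least le_join1 le_join2 le_trans join_closed by metis

text \<open>Testing with \<open>z = x\<close> and \<open>z = y\<close> yields both inequalities.
  Identities between joins thereby become propositional checks on upper bounds.\<close>

lemma eqI_upper_bounds:
  assumes "x \<in> carrier M" "y \<in> carrier M"
    and "\<And>z. z \<in> carrier M \<Longrightarrow> mv_le x z \<longleftrightarrow> mv_le y z"
  shows "x = y"
  using assms le_antisym le_refl by metis

lemma join_assoc:
  assumes "x \<in> carrier M" "y \<in> carrier M" "z \<in> carrier M"
  shows "mv_join (mv_join x y) z = mv_join x (mv_join y z)"
  using assms by (intro eqI_upper_bounds) (auto simp: join_le_iff)

text \<open>Residuation: unfolded, both sides set the sum of \<open>\<sim> x\<close>,
  \<open>\<sim> y\<close> and \<open>z\<close> equal to the top, with different bracketing.\<close>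

lemma mult_le_iff:
  assumes "x \<in> carrier M" "y \<in> carrier M" "z \<in> carrier M"
  shows "mv_le (mv_mult x y) z \<longleftrightarrow> mv_le x (\<sim> y \<boxplus> z)"
  using assms by (simp add: mv_le_def mv_mult_def plus_assoc)

text \<open>Multiplication by \<open>z\<close> is a left adjoint, hence preserves joins: an element
  \<open>w\<close> bounds either side iff \<open>x\<close> and \<open>y\<close> both lie below
  \<open>\<sim> z \<boxplus> w\<close>.\<close>

lemma join_mult_distrib:
  assumes "x \<in> carrier M" "y \<in> carrier M" "z \<in> carrier M"
  shows "mv_mult (mv_join x y) z = mv_join (mv_mult x z) (mv_mult y z)"
  using assms by (intro eqI_upper_bounds) (auto simp: join_le_iff mult_le_iff)

lemma mult_join_distrib:
  assumes "x \<in> carrier M" "y \<in> carrier M" "z \<in> carrier M"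
  shows "mv_mult z (mv_join x y) = mv_join (mv_mult z x) (mv_mult z y)"
  using assms join_mult_distrib by (simp add: mult_commute [of z])

text \<open>This identifies the order induced by the semiring sum with \<open>mv_le\<close>, so that
  antitonicity of \<alpha> becomes \<open>neg_antimono\<close>.\<close>

lemma join_eq_iff_le:
  assumes "x \<in> carrier M" "y \<in> carrier M"
  shows "mv_join x y = y \<longleftrightarrow> mv_le x y"
  using assms join_absorb le_join1 by metis

lemma zero_join: "x \<in> carrier M \<Longrightarrow> mv_join \<zero>\<^sub>m x = x"
  by (simp add: mv_join_def)

text \<open>Folding the operations into named constants lets the lemmas about joins and products
  apply directly to the record.\<close>

lemma luk_semiring_of_eq:
  "luk_semiring_of M =
    \<lparr>carrier = carrier M, monoid.mult = mv_mult, one = \<sim> \<zero>\<^sub>m,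
     ring.zero = \<zero>\<^sub>m, add = mv_join, luk_alpha = mv_neg M\<rparr>"
  by (simp add: luk_semiring_of_def mv_mult_def [abs_def] mv_join_def [abs_def])

lemma one_mult: "x \<in> carrier M \<Longrightarrow> mv_mult (\<sim> \<zero>\<^sub>m) x = x"
  and mult_one: "x \<in> carrier M \<Longrightarrow> mv_mult x (\<sim> \<zero>\<^sub>m) = x"
  and zero_mult: "x \<in> carrier M \<Longrightarrow> mv_mult \<zero>\<^sub>m x = \<zero>\<^sub>m"
  and mult_zero: "x \<in> carrier M \<Longrightarrow> mv_mult x \<zero>\<^sub>m = \<zero>\<^sub>m"
  by (simp_all add: mv_mult_def)

lemma semiring_luk_semiring_of: "semiring (luk_semiring_of M)"
  by (intro semiring.intro abelian_monoidI monoidI semiring_axioms.intro)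
    (simp_all add: luk_semiring_of_eq join_assoc mult_assoc zero_join join_mult_distrib
      mult_join_distrib one_mult mult_one zero_mult mult_zero, rule join_commute)

end

theorem corollary3:
  fixes M :: "('a, 'm) mv_structure_scheme"
  assumes "mv_algebra M"
  shows "lukasiewicz_semiring (luk_semiring_of M)"
proof -
  interpret mv_algebra M by fact
  show ?thesis
  proof (intro lukasiewicz_semiring.intro idempotent_semiring.intro
      semiring_luk_semiring_of idempotent_semiring_axioms.intro lukasiewicz_semiring_axioms.intro)
    fix x y
    let ?R = "luk_semiring_of M"
    assume x: "x \<in> carrier ?R"
    then show "x \<oplus>\<^bsub>?R\<^esub> x = x"
      by (simp add: luk_semiring_of_eq join_absorb)
    show "\<alpha>\<^bsub>?R\<^esub> x \<in> carrier ?R" and "\<alpha>\<^bsub>?R\<^esub> (\<alpha>\<^bsub>?R\<^esub> x) = x"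
      using x by (simp_all add: luk_semiring_of_eq)
    assume y: "y \<in> carrier ?R"
    show "\<alpha>\<^bsub>?R\<^esub> (x \<otimes>\<^bsub>?R\<^esub> \<alpha>\<^bsub>?R\<^esub> y) \<otimes>\<^bsub>?R\<^esub> \<alpha>\<^bsub>?R\<^esub> y = \<alpha>\<^bsub>?R\<^esub> (y \<otimes>\<^bsub>?R\<^esub> \<alpha>\<^bsub>?R\<^esub> x) \<otimes>\<^bsub>?R\<^esub> \<alpha>\<^bsub>?R\<^esub> x"
      \<comment> \<open>Cancelling double negations, the left side is the negated join of
        \<open>x\<close> and \<open>y\<close> and the right side that of \<open>y\<close> and
        \<open>x\<close>, so the law is the negated Lukasiewicz axiom.\<close>
      using x y lukasiewicz_axiom [of x y] by (simp add: luk_semiring_of_eq mv_mult_def)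
    assume "x \<sqsubseteq>\<^sub>+\<^bsub>?R\<^esub> y"
    then show "\<alpha>\<^bsub>?R\<^esub> y \<sqsubseteq>\<^sub>+\<^bsub>?R\<^esub> \<alpha>\<^bsub>?R\<^esub> x"
      using x y by (simp add: luk_semiring_of_eq semiring_le_def join_eq_iff_le neg_antimono)
  qed
qed

end
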